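(* Let $\Gamma=(V,E)$ be a finite, undirected, weighted, connected graph with $N\ge 2$ vertices (loops allowed), and let $\overline{h}$ be its dual Cheeger constant. Then $\overline{h}\le 1$, and $\overline{h}=1$ if and only if $\Gamma$ is bipartite.
   Context: The weight function $w:V\times V\to\mathbb{R}$ satisfies $w_{ij}=w_{ji}$, $w_{ij}>0$ if $i\sim j$ (i.e. $i,j$ are joined by an edge; $i=j$ allowed, a loop) and $w_{ij}=0$ otherwise. The degree is $d_i=\sum_{j}w_{ij}$; $\mathrm{vol}(U)=\sum_{i\in U}d_i$ for $U\subseteq V$; $|E(U,W)|=\sum_{k\in U,\,l\in W}w_{kl}$ for $U,W\subseteq V$. The dual Cheeger constant is $$\overline{h}=\max_{V_1,V_2}\frac{2|E(V_1,V_2)|}{\mathrm{vol}(V_1)+\mathrm{vol}(V_2)},$$ the maximum being over all partitions of $V$ into disjoint sets $V_1,V_2,V_3$ with $V_1,V_2$ nonempty ($V_3=V\setminus(V_1\cup V_2)$ may be empty). A graph is bipartite if $V$ is a disjoint union of two classes such that no two vertices of the same class are joined by an edge (in particular there are no loops). *)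

theory Defs
  imports Complex_Main "Graph_Theory.Graph_Theory"
begin

text \<open>
  A finite undirected graph with loops but without parallel edges is a
  \<^locale>\<open>pair_pseudo_graph\<close>: an undirected edge between distinct \<open>i\<close>, \<open>j\<close> is the pair of arcs
  \<open>(i, j)\<close>, \<open>(j, i)\<close>, and a loop at \<open>i\<close> is the single arc \<open>(i, i)\<close>. The values of the weight
  function outside \<open>V \<times> V\<close> are unconstrained and never used.
\<close>

locale weighted_pseudo_graph = pair_pseudo_graph G for G :: "'a pair_pre_digraph" +
  fixes w :: "'a \<Rightarrow> 'a \<Rightarrow> real"
  assumes weight_sym: "\<lbrakk>i \<in> pverts G; j \<in> pverts G\<rbrakk> \<Longrightarrow> w i j = w j i"
    and weight_pos: "(i, j) \<in> parcs G \<Longrightarrow> w i j > 0"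
    and weight_zero: "\<lbrakk>i \<in> pverts G; j \<in> pverts G; (i, j) \<notin> parcs G\<rbrakk> \<Longrightarrow> w i j = 0"

definition weighted_degree :: "'a pair_pre_digraph \<Rightarrow> ('a \<Rightarrow> 'a \<Rightarrow> real) \<Rightarrow> 'a \<Rightarrow> real" where
  "weighted_degree G w i = (\<Sum>j\<in>pverts G. w i j)"

definition vol :: "'a pair_pre_digraph \<Rightarrow> ('a \<Rightarrow> 'a \<Rightarrow> real) \<Rightarrow> 'a set \<Rightarrow> real" where
  "vol G w U = (\<Sum>i\<in>U. weighted_degree G w i)"

definition edge_weight :: "('a \<Rightarrow> 'a \<Rightarrow> real) \<Rightarrow> 'a set \<Rightarrow> 'a set \<Rightarrow> real" where
  "edge_weight w U W = (\<Sum>k\<in>U. \<Sum>l\<in>W. w k l)"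

text \<open>
  The third block \<open>V\<^sub>3 = V - (V\<^sub>1 \<union> V\<^sub>2)\<close> is determined by the other two and may be empty, so the
  maximum ranges over pairs of disjoint nonempty sets of vertices. There are finitely many such
  pairs, and at least one as soon as there are two vertices.
\<close>

definition dual_cheeger :: "'a pair_pre_digraph \<Rightarrow> ('a \<Rightarrow> 'a \<Rightarrow> real) \<Rightarrow> real" where
  "dual_cheeger G w =
     Max {2 * edge_weight w V\<^sub>1 V\<^sub>2 / (vol G w V\<^sub>1 + vol G w V\<^sub>2) | V\<^sub>1 V\<^sub>2.
       V\<^sub>1 \<subseteq> pverts G \<and> V\<^sub>2 \<subseteq> pverts G \<and> V\<^sub>1 \<noteq> {} \<and> V\<^sub>2 \<noteq> {} \<and> V\<^sub>1 \<inter> V\<^sub>2 = {}}"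

definition bipartite :: "'a pair_pre_digraph \<Rightarrow> bool" where
  "bipartite G \<longleftrightarrow> (\<exists>A B. A \<union> B = pverts G \<and> A \<inter> B = {} \<and>
     (\<forall>i\<in>A. \<forall>j\<in>A. (i, j) \<notin> parcs G) \<and> (\<forall>i\<in>B. \<forall>j\<in>B. (i, j) \<notin> parcs G))"

end

theory Submission
  imports Defs
begin

text \<open>
  Splitting each degree over \<open>V\<^sub>1\<close>, \<open>V\<^sub>2\<close> and \<open>V\<^sub>3\<close> gives
  \<open>vol(V\<^sub>1) + vol(V\<^sub>2) = 2|E(V\<^sub>1,V\<^sub>2)| + |E(V\<^sub>1,V\<^sub>1)| + |E(V\<^sub>2,V\<^sub>2)| + |E(V\<^sub>1 \<union> V\<^sub>2,V\<^sub>3)|\<close>.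
  So every quotient is at most 1, and one of positive volume equals 1 exactly when the last three
  terms vanish: there are then no edges inside \<open>V\<^sub>1\<close> or \<open>V\<^sub>2\<close>, and connectedness forces \<open>V\<^sub>3\<close> to be
  empty.
\<close>

text \<open>Symmetry makes a connected graph strongly connected, so a directed walk leads from
  \<open>S\<close> to a vertex outside and must cross the boundary of \<open>S\<close> somewhere.
  This is the only form in which connectedness is used below.\<close>

lemma (in pair_sym_digraph) connected_cut_arc:
  assumes conn: "Digraph_Component.connected (with_proj G)"
    and "S \<subseteq> pverts G" "S \<noteq> {}" "S \<noteq> pverts G"
  obtains i j where "i \<in> S" "j \<in> pverts G - S" "(i, j) \<in> parcs G"
proof -
  from assms obtain u v where uv: "u \<in> S" "v \<in> pverts G - S" "u \<in> pverts G" by blast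
  have "strongly_connected (with_proj G)"
    using symmetric_connected_imp_strongly_connected[OF pair_sym_arcs conn] .
  then have "u \<rightarrow>\<^sup>*\<^bsub>with_proj G\<^esub> v"
    using uv by (auto simp: strongly_connected_def)
  \<comment> \<open>Invariant along the walk: its current end is still in \<open>S\<close>, or an
    arc leaving \<open>S\<close> exists.\<close>
  then have "v \<in> S \<or> (\<exists>i\<in>S. \<exists>j\<in>pverts G - S. (i, j) \<in> parcs G)"
  proof (induction rule: reachable_induct)
    case base
    then show ?case using uv by simp
  next
    case (step x y)
    then show ?case using in_arcsD2 by auto
  qed
  then show thesis using uv that by blast
qed

lemma edge_weight_commute:
  assumes "\<And>k l. k \<in> U \<Longrightarrow> l \<in> W \<Longrightarrow> w k l = w l k"
  shows "edge_weight w U W = edge_weight w W U"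
  unfolding edge_weight_def using assms by (subst sum.swap) (simp cong: sum.cong)

context weighted_pseudo_graph
begin

lemma weight_nonneg: "i \<in> pverts G \<Longrightarrow> j \<in> pverts G \<Longrightarrow> 0 \<le> w i j"
  using weight_pos[of i j] weight_zero[of i j] by fastforce

lemma edge_weight_nonneg:
  "U \<subseteq> pverts G \<Longrightarrow> W \<subseteq> pverts G \<Longrightarrow> 0 \<le> edge_weight w U W"
  unfolding edge_weight_def by (intro sum_nonneg weight_nonneg) auto

text \<open>A sum of nonnegative terms vanishes only termwise, and weights are positive exactly on
  arcs. This translates vanishing terms of the volume decomposition into missing arcs.\<close>

lemma edge_weight_eq_0_iff:
  assumes "U \<subseteq> pverts G" "W \<subseteq> pverts G"
  shows "edge_weight w U W = 0 \<longleftrightarrow> (\<forall>i\<in>U. \<forall>j\<in>W. (i, j) \<notin> parcs G)"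
proof -
  have fin: "finite U" "finite W"
    using assms pair_finite_verts finite_subset by blast+
  have "edge_weight w U W = 0 \<longleftrightarrow> (\<forall>i\<in>U. (\<Sum>j\<in>W. w i j) = 0)"
    unfolding edge_weight_def using assms fin
    by (intro sum_nonneg_eq_0_iff sum_nonneg weight_nonneg) auto
  also have "\<dots> \<longleftrightarrow> (\<forall>i\<in>U. \<forall>j\<in>W. w i j = 0)"
    using assms fin by (intro ball_cong refl sum_nonneg_eq_0_iff weight_nonneg) auto
  also have "\<dots> \<longleftrightarrow> (\<forall>i\<in>U. \<forall>j\<in>W. (i, j) \<notin> parcs G)"
    using assms weight_pos weight_zero by (metis less_irrefl subsetD)
  finally show ?thesis .
qed

lemma vol_conv_edge_weight: "vol G w U = edge_weight w U (pverts G)"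
  by (simp add: vol_def weighted_degree_def edge_weight_def)

lemma vol_sum_decomposition:
  assumes "A \<subseteq> pverts G" "B \<subseteq> pverts G" "A \<inter> B = {}"
  shows "vol G w A + vol G w B = 2 * edge_weight w A B + edge_weight w A A + edge_weight w B B
    + edge_weight w (A \<union> B) (pverts G - (A \<union> B))"
proof -
  let ?R = "pverts G - (A \<union> B)"
  have fin: "finite A" "finite B" "finite ?R"
    using assms pair_finite_verts finite_subset by blast+
  have deg: "(\<Sum>j\<in>pverts G. w i j) = (\<Sum>j\<in>A. w i j) + (\<Sum>j\<in>B. w i j) + (\<Sum>j\<in>?R. w i j)" for i
    using assms fin sum.subset_diff[of "A \<union> B" "pverts G" "w i"]
    by (simp add: sum.union_disjoint pair_finite_verts)
  have "edge_weight w U (pverts G) = edge_weight w U A + edge_weight w U B + edge_weight w U ?R"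
    for U by (simp add: edge_weight_def deg sum.distrib)
  moreover have "edge_weight w (A \<union> B) ?R = edge_weight w A ?R + edge_weight w B ?R"
    unfolding edge_weight_def using assms fin by (intro sum.union_disjoint)
  \<comment> \<open>By symmetry the mixed terms from \<open>A\<close> and from \<open>B\<close>
    agree, whence the factor 2.\<close>
  moreover have "edge_weight w B A = edge_weight w A B"
    using assms weight_sym by (intro edge_weight_commute) blast
  ultimately show ?thesis by (simp add: vol_conv_edge_weight)
qed

lemma double_edge_weight_le_vol:
  assumes "A \<subseteq> pverts G" "B \<subseteq> pverts G" "A \<inter> B = {}"
  shows "2 * edge_weight w A B \<le> vol G w A + vol G w B"
  using edge_weight_nonneg[of A A] edge_weight_nonneg[of B B]
    edge_weight_nonneg[of "A \<union> B" "pverts G - (A \<union> B)"] vol_sum_decomposition[OF assms] assms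
  by auto

lemma double_edge_weight_eq_vol_iff:
  assumes "A \<subseteq> pverts G" "B \<subseteq> pverts G" "A \<inter> B = {}"
  shows "2 * edge_weight w A B = vol G w A + vol G w B \<longleftrightarrow>
    (\<forall>i\<in>A. \<forall>j\<in>A. (i, j) \<notin> parcs G) \<and> (\<forall>i\<in>B. \<forall>j\<in>B. (i, j) \<notin> parcs G) \<and>
    (\<forall>i\<in>A \<union> B. \<forall>j\<in>pverts G - (A \<union> B). (i, j) \<notin> parcs G)"
proof -
  let ?R = "pverts G - (A \<union> B)"
  have sub: "A \<union> B \<subseteq> pverts G" "?R \<subseteq> pverts G" using assms by auto
  have "2 * edge_weight w A B = vol G w A + vol G w B \<longleftrightarrow>
      edge_weight w A A = 0 \<and> edge_weight w B B = 0 \<and> edge_weight w (A \<union> B) ?R = 0"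
    using edge_weight_nonneg[of A A] edge_weight_nonneg[of B B] edge_weight_nonneg[OF sub]
      vol_sum_decomposition[OF assms] assms by linarith
  then show ?thesis using assms sub by (simp only: edge_weight_eq_0_iff)
qed

text \<open>With at least two vertices, \<open>{a}\<close> is a proper subset for any
  \<open>a\<close> in \<open>U\<close>, so an arc leaves \<open>a\<close> and contributes positive
  weight. Hence the denominators of the quotients are positive, and the value 0 of division by zero
  never intervenes.\<close>

lemma vol_pos:
  assumes conn: "Digraph_Component.connected (with_proj G)" and card: "card (pverts G) \<ge> 2"
    and U: "U \<subseteq> pverts G" "U \<noteq> {}"
  shows "0 < vol G w U"
proof -
  from U obtain a where a: "a \<in> U" "a \<in> pverts G" by blast
  have "{a} \<noteq> pverts G" using card by (auto dest: sym)
  then obtain j where "j \<in> pverts G" "(a, j) \<in> parcs G"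
    using connected_cut_arc[OF conn, of "{a}"] a by blast
  then have "edge_weight w U (pverts G) \<noteq> 0"
    using edge_weight_eq_0_iff[OF U(1) subset_refl] a by blast
  with edge_weight_nonneg[OF U(1) subset_refl] show ?thesis
    by (simp add: vol_conv_edge_weight)
qed

end

theorem theorem3p1:
  fixes G :: "'a pair_pre_digraph" and w :: "'a \<Rightarrow> 'a \<Rightarrow> real"
  assumes "weighted_pseudo_graph G w"
    and "Digraph_Component.connected (with_proj G)"
    and "card (pverts G) \<ge> 2"
  shows "dual_cheeger G w \<le> 1 \<and> (dual_cheeger G w = 1 \<longleftrightarrow> bipartite G)"
proof -
  interpret weighted_pseudo_graph G w by fact
  define adm where "adm A B \<longleftrightarrow> A \<subseteq> pverts G \<and> B \<subseteq> pverts G \<and> A \<noteq> {} \<and> B \<noteq> {} \<and> A \<inter> B = {}"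
    for A B
  define q where "q A B = 2 * edge_weight w A B / (vol G w A + vol G w B)" for A B
  define Q where "Q = {q A B | A B. adm A B}"
  have h: "dual_cheeger G w = Max Q"
    unfolding dual_cheeger_def Q_def q_def adm_def ..
  \<comment> \<open>\<open>Max\<close> is meaningful only on a finite nonempty set. Finiteness comes
    from the finitely many pairs of subsets, nonemptiness from two distinct singletons.\<close>
  have "Q \<subseteq> case_prod q ` (Pow (pverts G) \<times> Pow (pverts G))"
    unfolding Q_def adm_def by auto
  then have fin: "finite Q"
    by (rule finite_subset) (simp add: pair_finite_verts)
  from assms(3) obtain a b where "a \<in> pverts G" "b \<in> pverts G" "a \<noteq> b"
    by (metis card_le_Suc0_iff_eq not_less_eq_eq numeral_2_eq_2 pair_finite_verts)
  then have "adm {a} {b}" by (simp add: adm_def)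
  then have ne: "Q \<noteq> {}" unfolding Q_def by blast
  have pos: "0 < vol G w A + vol G w B" if "adm A B" for A B
    using that vol_pos[OF assms(2,3)] unfolding adm_def by (simp add: add_pos_pos)
  have q_le: "q A B \<le> 1" if "adm A B" for A B
    using pos[OF that] double_edge_weight_le_vol[of A B] that by (simp add: q_def adm_def)
  have q_eq: "q A B = 1 \<longleftrightarrow> 2 * edge_weight w A B = vol G w A + vol G w B" if "adm A B" for A B
    using pos[OF that] by (auto simp: q_def)
  have Q_le: "x \<le> 1" if "x \<in> Q" for x
    using that q_le unfolding Q_def by blast
  have le: "Max Q \<le> 1" using fin ne Q_le by simp
  \<comment> \<open>Since 1 bounds \<open>Q\<close> from above, the maximum equals 1 exactly when
    some admissible pair attains it.\<close>
  have "Max Q = 1 \<longleftrightarrow> 1 \<in> Q"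
    unfolding Max_eq_iff[OF fin ne] using Q_le by blast
  also have "\<dots> \<longleftrightarrow> (\<exists>A B. adm A B \<and> 2 * edge_weight w A B = vol G w A + vol G w B)"
  proof -
    have "1 \<in> Q \<longleftrightarrow> (\<exists>A B. adm A B \<and> q A B = 1)"
      unfolding Q_def mem_Collect_eq by metis
    then show ?thesis using q_eq by blast
  qed
  also have "\<dots> \<longleftrightarrow> bipartite G"
  proof
    assume "\<exists>A B. adm A B \<and> 2 * edge_weight w A B = vol G w A + vol G w B"
    then obtain A B where AB: "adm A B" "2 * edge_weight w A B = vol G w A + vol G w B" by blast
    then have no_arc: "\<forall>i\<in>A. \<forall>j\<in>A. (i, j) \<notin> parcs G" "\<forall>i\<in>B. \<forall>j\<in>B. (i, j) \<notin> parcs G"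
        "\<forall>i\<in>A \<union> B. \<forall>j\<in>pverts G - (A \<union> B). (i, j) \<notin> parcs G"
      using double_edge_weight_eq_vol_iff[of A B] unfolding adm_def by blast+
    have "A \<union> B = pverts G"
      proof (rule ccontr)
      assume "A \<union> B \<noteq> pverts G"
      moreover have "A \<union> B \<subseteq> pverts G" "A \<union> B \<noteq> {}" using AB(1) by (auto simp: adm_def)
      ultimately obtain i j where "i \<in> A \<union> B" "j \<in> pverts G - (A \<union> B)" "(i, j) \<in> parcs G"
        using connected_cut_arc[OF assms(2)] by metis
      then show False using no_arc(3) by blast
    qed
    then show "bipartite G"
      using no_arc AB(1) unfolding bipartite_def adm_def by blast
  next
    assume "bipartite G"
    then obtain A B where AB: "A \<union> B = pverts G" "A \<inter> B = {}"
      and no_arc: "\<forall>i\<in>A. \<forall>j\<in>A. (i, j) \<notin> parcs G" "\<forall>i\<in>B. \<forall>j\<in>B. (i, j) \<notin> parcs G"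
      unfolding bipartite_def by blast
    \<comment> \<open>\<open>bipartite\<close> permits an empty class, \<open>adm\<close> does not.
      Positive total volume yields an arc; were one class empty, both ends of this arc would lie in
      the other class.\<close>
    have "0 < vol G w (pverts G)"
      using vol_pos[OF assms(2,3) subset_refl] assms(3) by fastforce
    then have "\<exists>i\<in>pverts G. \<exists>j\<in>pverts G. (i, j) \<in> parcs G"
      using edge_weight_eq_0_iff[of "pverts G" "pverts G"] by (auto simp: vol_conv_edge_weight)
    then have "A \<noteq> {}" "B \<noteq> {}" using AB no_arc by auto
    then have "adm A B" using AB unfolding adm_def by blast
    \<comment> \<open>The two classes exhaust the vertices, so the condition on arcs into the third
      block is vacuous.\<close>
    moreover have "2 * edge_weight w A B = vol G w A + vol G w B"
      using double_edge_weight_eq_vol_iff[of A B] AB no_arc by auto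
    ultimately show "\<exists>A B. adm A B \<and> 2 * edge_weight w A B = vol G w A + vol G w B" by blast
  qed
  finally show ?thesis using le h by simp
qed

end
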